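(* Let $\mathcal{X}$ and $\mathcal{U}$ be nonempty compact sets and let $f:\mathcal{X}\times\mathcal{U}\to\mathbb{R}$ be a bounded function that is upper semicontinuous in its first argument and lower semicontinuous in its second argument. Suppose that $\mathcal{U}$ is a convex set and that $\theta\mapsto f(x,\theta)$ is a convex function on $\mathcal{U}$ for every $x\in\mathcal{X}$. Then for every $x\in\mathcal{X}$ the function $$v_x(\eta):=\min_{\theta\in\mathcal{U}_\eta}f(x,\theta)$$ is nonincreasing, convex, and continuous for $\eta\in[\underline{\eta},\infty)$.
   Context: $\mathcal{X}$ is a subset of a topological space and $\mathcal{U}$ is a subset of a real vector space equipped with a topology; both may be infinite-dimensional. Compact means every open cover has a finite subcover. Semicontinuity in an argument means semicontinuity of the function of that argument when the other argument is fixed. For $\eta\in\mathbb{R}$ the reduced uncertainty set is $\mathcal{U}_\eta:=\{\theta\in\mathcal{U}:\max_{x'\in\mathcal{X}}f(x',\theta)\le\eta\}$, and $\underline{\eta}:=\min\{\eta\in\mathbb{R}:\mathcal{U}_\eta\neq\emptyset\}$. *)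

theory Defs
  imports "HOL-Analysis.Analysis"
begin

text \<open>
  Semicontinuity relative to a subset \<open>S\<close> of the domain, that is, of the restriction of \<open>g\<close> to
  \<open>S\<close> with the subspace topology. The filter \<open>at x within S\<close> omits the point \<open>x\<close>, which is
  harmless because the condition holds at \<open>x\<close> by assumption; no separation axiom is needed.
\<close>

definition lower_semicontinuous_on :: "'a::topological_space set \<Rightarrow> ('a \<Rightarrow> real) \<Rightarrow> bool" where
  "lower_semicontinuous_on S g \<longleftrightarrow>
     (\<forall>x\<in>S. \<forall>c. c < g x \<longrightarrow> (\<forall>\<^sub>F y in at x within S. c < g y))"

definition upper_semicontinuous_on :: "'a::topological_space set \<Rightarrow> ('a \<Rightarrow> real) \<Rightarrow> bool" where
  "upper_semicontinuous_on S g \<longleftrightarrow>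
     (\<forall>x\<in>S. \<forall>c. g x < c \<longrightarrow> (\<forall>\<^sub>F y in at x within S. g y < c))"

text \<open>
  The library's \<open>Max\<close> and \<open>Min\<close> are meant for finite sets, so extrema of arbitrary sets of reals
  are expressed by \<open>GREATEST\<close> and \<open>LEAST\<close>. These are unspecified if no extremum exists; existence
  is expressed by \<open>has_maximum\<close> and \<open>has_minimum\<close>.
\<close>

definition has_maximum :: "real set \<Rightarrow> bool" where
  "has_maximum A \<longleftrightarrow> (\<exists>m\<in>A. \<forall>a\<in>A. a \<le> m)"

definition has_minimum :: "real set \<Rightarrow> bool" where
  "has_minimum A \<longleftrightarrow> (\<exists>m\<in>A. \<forall>a\<in>A. m \<le> a)"

definition maximum :: "real set \<Rightarrow> real" where
  "maximum A = (GREATEST m. m \<in> A)"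

definition minimum :: "real set \<Rightarrow> real" where
  "minimum A = (LEAST m. m \<in> A)"

definition reduced_uncertainty_set ::
    "'a set \<Rightarrow> 'b set \<Rightarrow> ('a \<times> 'b \<Rightarrow> real) \<Rightarrow> real \<Rightarrow> 'b set" where
  "reduced_uncertainty_set X U f \<eta> = {\<theta> \<in> U. maximum ((\<lambda>x'. f (x', \<theta>)) ` X) \<le> \<eta>}"

definition feasible_levels :: "'a set \<Rightarrow> 'b set \<Rightarrow> ('a \<times> 'b \<Rightarrow> real) \<Rightarrow> real set" where
  "feasible_levels X U f = {\<eta>. reduced_uncertainty_set X U f \<eta> \<noteq> {}}"

definition eta_min :: "'a set \<Rightarrow> 'b set \<Rightarrow> ('a \<times> 'b \<Rightarrow> real) \<Rightarrow> real" where
  "eta_min X U f = minimum (feasible_levels X U f)"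

definition reduced_value ::
    "'a set \<Rightarrow> 'b set \<Rightarrow> ('a \<times> 'b \<Rightarrow> real) \<Rightarrow> 'a \<Rightarrow> real \<Rightarrow> real" where
  "reduced_value X U f x \<eta> = minimum ((\<lambda>\<theta>. f (x, \<theta>)) ` reduced_uncertainty_set X U f \<eta>)"

end

theory Submission
  imports Defs
begin

text \<open>
  The worst-case function \<open>F \<theta> = max\<^sub>x f (x, \<theta>)\<close> is again convex and lower semicontinuous, and
  the reduced uncertainty sets are its sublevel sets, so everything reduces to minimising one convex
  lower semicontinuous function \<open>h\<close> over the sublevel sets of another one, \<open>F\<close>. Convexity makes
  the optimal value continuous in the interior of \<open>[min F, \<infinity>)\<close>. At the left endpoint only lower
  semicontinuity needs an argument: if \<open>c\<close> is below the value at \<open>\<eta>\<close>, then the minimum of \<open>F\<close> over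
  the compact set \<open>h \<le> c\<close> exceeds \<open>\<eta>\<close>, and the value stays above \<open>c\<close> up to that minimum.
\<close>

section \<open>Attained extrema of sets of reals\<close>

lemma minimum_properties:
  assumes "has_minimum A"
  shows minimum_in: "minimum A \<in> A"
    and minimum_le: "a \<in> A \<Longrightarrow> minimum A \<le> a"
proof -
  obtain m where m: "m \<in> A" "\<And>a. a \<in> A \<Longrightarrow> m \<le> a"
    using assms unfolding has_minimum_def by blast
  have "minimum A = m"
    unfolding minimum_def using m by (intro Least_equality) auto
  then show "minimum A \<in> A" "a \<in> A \<Longrightarrow> minimum A \<le> a"
    using m by auto
qed

lemma maximum_properties:
  assumes "has_maximum A"
  shows maximum_in: "maximum A \<in> A"
    and maximum_ge: "a \<in> A \<Longrightarrow> a \<le> maximum A"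
proof -
  obtain m where m: "m \<in> A" "\<And>a. a \<in> A \<Longrightarrow> a \<le> m"
    using assms unfolding has_maximum_def by blast
  have "maximum A = m"
    unfolding maximum_def using m by (intro Greatest_equality) auto
  then show "maximum A \<in> A" "a \<in> A \<Longrightarrow> a \<le> maximum A"
    using m by auto
qed

section \<open>Semicontinuity and compactness\<close>

text \<open>Passes from the pointwise filter condition to open sets \<open>T\<close> of the ambient
  space, the form in which compactness can be applied.\<close>

lemma lower_semicontinuous_on_superlevel_open:
  assumes "lower_semicontinuous_on S g"
  obtains T where "open T" "{x \<in> S. c < g x} = S \<inter> T"
proof -
  have "openin (top_of_set S) {x \<in> S. c < g x}"
  proof (subst openin_subopen, intro ballI)
    fix x assume x: "x \<in> {x \<in> S. c < g x}"
    then have "\<forall>\<^sub>F y in at x within S. c < g y"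
      using assms unfolding lower_semicontinuous_on_def by blast
    then obtain V where V: "open V" "x \<in> V" "\<And>y. \<lbrakk>y \<in> V; y \<noteq> x; y \<in> S\<rbrakk> \<Longrightarrow> c < g y"
      unfolding eventually_at_topological by blast
    have "openin (top_of_set S) (S \<inter> V)"
      using V(1) by (rule openin_open_Int)
    moreover have "x \<in> S \<inter> V" "S \<inter> V \<subseteq> {x \<in> S. c < g x}"
      using x V by auto
    ultimately show "\<exists>T. openin (top_of_set S) T \<and> x \<in> T \<and> T \<subseteq> {x \<in> S. c < g x}"
      by blast
  qed
  then show ?thesis
    using that unfolding openin_open by blast
qed

lemma lower_semicontinuous_on_subset:
  assumes "lower_semicontinuous_on S g" "T \<subseteq> S"
  shows "lower_semicontinuous_on T g"
  using assms unfolding lower_semicontinuous_on_def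
  by (blast intro: filter_leD[OF at_le])

lemma lower_semicontinuous_on_uminus:
  assumes "upper_semicontinuous_on S g"
  shows "lower_semicontinuous_on S (\<lambda>x. - g x)"
  unfolding lower_semicontinuous_on_def
proof (intro ballI allI impI)
  fix x c assume "x \<in> S" "c < - g x"
  then have "\<forall>\<^sub>F y in at x within S. g y < - c"
    using assms unfolding upper_semicontinuous_on_def by force
  then show "\<forall>\<^sub>F y in at x within S. c < - g y"
    by eventually_elim linarith
qed

text \<open>A sublevel set is what remains of \<open>S\<close> after removing an open set, so it
  inherits compactness even in a space that is not Hausdorff, where \<open>S\<close> itself may fail
  to be closed.\<close>

lemma compact_sublevel:
  assumes "compact S" "lower_semicontinuous_on S g"
  shows "compact {x \<in> S. g x \<le> c}"
proof -
  obtain T where T: "open T" "{x \<in> S. c < g x} = S \<inter> T"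
    using lower_semicontinuous_on_superlevel_open[OF assms(2)] by blast
  have "{x \<in> S. g x \<le> c} = S \<inter> - T"
    using T(2) by (auto simp: not_less[symmetric])
  then show ?thesis
    using assms(1) T(1) by (metis closed_Compl compact_Int_closed)
qed

text \<open>If no minimum were attained, the strict superlevel sets of the values of
  \<open>g\<close> would cover \<open>S\<close>. Among the finitely many points indexing a subcover,
  one with the smallest value is left uncovered.\<close>

lemma lower_semicontinuous_on_has_minimum:
  assumes "compact S" "S \<noteq> {}" "lower_semicontinuous_on S g"
  shows "has_minimum (g ` S)"
proof (rule ccontr)
  assume "\<not> has_minimum (g ` S)"
  then have smaller: "\<exists>y\<in>S. g y < g x" if "x \<in> S" for x
    using that unfolding has_minimum_def by (auto simp: not_le)
  obtain T where T: "\<And>y. open (T y)" "\<And>y. {x \<in> S. g y < g x} = S \<inter> T y"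
  proof -
    have "\<exists>T. open T \<and> {x \<in> S. g y < g x} = S \<inter> T" for y
      using lower_semicontinuous_on_superlevel_open[OF assms(3)] by blast
    then show ?thesis using that by metis
  qed
  have "S \<subseteq> (\<Union>y\<in>S. T y)"
    using smaller T(2) by blast
  then obtain D where D: "D \<subseteq> S" "finite D" "S \<subseteq> (\<Union>y\<in>D. T y)"
    using compactE_image[OF assms(1), of S T] T(1) by blast
  with assms(2) have "D \<noteq> {}" by auto
  then obtain d where d: "d \<in> D" "\<And>y. y \<in> D \<Longrightarrow> g d \<le> g y"
    using arg_min_if_finite(1)[OF D(2), of g] arg_min_least[OF D(2), of _ g] by blast
  with D obtain y where "y \<in> D" "d \<in> T y" by blast
  then have "g y < g d" using T(2)[of y] d(1) D(1) by blast
  with d(2)[OF \<open>y \<in> D\<close>] show False by simp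
qed

lemma upper_semicontinuous_on_has_maximum:
  assumes "compact S" "S \<noteq> {}" "upper_semicontinuous_on S g"
  shows "has_maximum (g ` S)"
  using lower_semicontinuous_on_has_minimum[OF assms(1,2) lower_semicontinuous_on_uminus[OF assms(3)]]
  unfolding has_minimum_def has_maximum_def by auto

section \<open>The worst-case function\<close>

lemma lower_semicontinuous_on_maximum:
  assumes max: "\<And>\<theta>. \<theta> \<in> U \<Longrightarrow> has_maximum ((\<lambda>x. f (x, \<theta>)) ` X)"
    and lsc: "\<And>x. x \<in> X \<Longrightarrow> lower_semicontinuous_on U (\<lambda>\<theta>. f (x, \<theta>))"
  shows "lower_semicontinuous_on U (\<lambda>\<theta>. maximum ((\<lambda>x. f (x, \<theta>)) ` X))"
  unfolding lower_semicontinuous_on_def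
proof (intro ballI allI impI)
  fix \<theta> c assume \<theta>: "\<theta> \<in> U" and c: "c < maximum ((\<lambda>x. f (x, \<theta>)) ` X)"
  \<comment> \<open>A maximiser at \<open>\<theta>\<close> suffices: its own lower semicontinuity
    keeps \<open>f (x, \<theta>')\<close> above \<open>c\<close> nearby, and the maximum at
    \<open>\<theta>'\<close> is at least that value.\<close>
  then obtain x where x: "x \<in> X" "c < f (x, \<theta>)"
    using maximum_in[OF max[OF \<theta>]] by auto
  then have "\<forall>\<^sub>F \<theta>' in at \<theta> within U. c < f (x, \<theta>')"
    using lsc \<theta> unfolding lower_semicontinuous_on_def by blast
  \<comment> \<open>The maximum at \<open>\<theta>'\<close> is known to be attained only for
    \<open>\<theta>'\<close> in \<open>U\<close>.\<close>
  moreover have "\<forall>\<^sub>F \<theta>' in at \<theta> within U. \<theta>' \<in> U"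
    by (simp add: eventually_at_topological exI[of _ UNIV])
  ultimately show "\<forall>\<^sub>F \<theta>' in at \<theta> within U. c < maximum ((\<lambda>x. f (x, \<theta>')) ` X)"
  proof eventually_elim
    case (elim \<theta>')
    have "f (x, \<theta>') \<le> maximum ((\<lambda>x. f (x, \<theta>')) ` X)"
      using x(1) by (intro maximum_ge max elim(2)) blast
    with elim(1) show ?case by linarith
  qed
qed

text \<open>Convexity of one slice is enough, namely the slice at an \<open>x\<close> that attains
  the maximum at the convex combination.\<close>

lemma convex_on_maximum:
  assumes max: "\<And>\<theta>. \<theta> \<in> U \<Longrightarrow> has_maximum ((\<lambda>x. f (x, \<theta>)) ` X)"
    and U: "convex U"
    and conv: "\<And>x. x \<in> X \<Longrightarrow> convex_on U (\<lambda>\<theta>. f (x, \<theta>))"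
  shows "convex_on U (\<lambda>\<theta>. maximum ((\<lambda>x. f (x, \<theta>)) ` X))" (is "convex_on U ?F")
  unfolding convex_on_def
proof (intro conjI ballI allI impI U)
  fix a b and u v :: real
  assume ab: "a \<in> U" "b \<in> U" and uv: "0 \<le> u" "0 \<le> v" "u + v = 1"
  have in_U: "u *\<^sub>R a + v *\<^sub>R b \<in> U"
    using U ab uv by (rule convexD)
  then obtain x where x: "x \<in> X" "?F (u *\<^sub>R a + v *\<^sub>R b) = f (x, u *\<^sub>R a + v *\<^sub>R b)"
    using maximum_in[OF max] by blast
  have le: "f (x, \<theta>) \<le> ?F \<theta>" if "\<theta> \<in> U" for \<theta>
    using maximum_ge[OF max[OF that]] x(1) by blast
  have "f (x, u *\<^sub>R a + v *\<^sub>R b) \<le> u * f (x, a) + v * f (x, b)"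
    using conv[OF x(1)] ab uv unfolding convex_on_def by blast
  also have "\<dots> \<le> u * ?F a + v * ?F b"
    using le ab uv by (intro add_mono mult_left_mono) auto
  finally show "?F (u *\<^sub>R a + v *\<^sub>R b) \<le> u * ?F a + v * ?F b"
    using x(2) by simp
qed

section \<open>Minimising one function over the sublevel sets of another\<close>

lemma minimum_sublevel_has_minimum:
  assumes "compact U" "lower_semicontinuous_on U F" "lower_semicontinuous_on U h"
    and "\<theta> \<in> U" "F \<theta> \<le> \<eta>"
  shows "has_minimum (h ` {\<theta> \<in> U. F \<theta> \<le> \<eta>})"
proof (rule lower_semicontinuous_on_has_minimum)
  show "compact {\<theta> \<in> U. F \<theta> \<le> \<eta>}"
    using assms(1,2) by (rule compact_sublevel)
  show "lower_semicontinuous_on {\<theta> \<in> U. F \<theta> \<le> \<eta>} h"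
    using assms(3) by (rule lower_semicontinuous_on_subset) auto
qed (use assms(4,5) in auto)

lemma minimum_sublevel_antimono:
  fixes F h :: "'a \<Rightarrow> real"
  assumes min: "\<And>\<eta>. \<eta> \<in> I \<Longrightarrow> has_minimum (h ` {\<theta> \<in> U. F \<theta> \<le> \<eta>})"
  shows "antimono_on I (\<lambda>\<eta>. minimum (h ` {\<theta> \<in> U. F \<theta> \<le> \<eta>}))"
proof (rule monotone_onI)
  fix s t assume st: "s \<in> I" "t \<in> I" "s \<le> t"
  have "minimum (h ` {\<theta> \<in> U. F \<theta> \<le> s}) \<in> h ` {\<theta> \<in> U. F \<theta> \<le> t}"
    by (rule subsetD[OF image_mono minimum_in[OF min[OF st(1)]]]) (use st(3) in auto)
  then show "minimum (h ` {\<theta> \<in> U. F \<theta> \<le> t}) \<le> minimum (h ` {\<theta> \<in> U. F \<theta> \<le> s})"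
    by (rule minimum_le[OF min[OF st(2)]])
qed

text \<open>Combining minimisers for the levels \<open>s\<close> and \<open>t\<close> gives a point
  that is feasible for the combined level, by convexity of \<open>F\<close>, and whose value is
  bounded as required, by convexity of \<open>h\<close>.\<close>

lemma minimum_sublevel_convex_on:
  fixes F h :: "'a::real_vector \<Rightarrow> real"
  assumes "convex I" "convex_on U F" "convex_on U h"
    and min: "\<And>\<eta>. \<eta> \<in> I \<Longrightarrow> has_minimum (h ` {\<theta> \<in> U. F \<theta> \<le> \<eta>})"
  shows "convex_on I (\<lambda>\<eta>. minimum (h ` {\<theta> \<in> U. F \<theta> \<le> \<eta>}))" (is "convex_on I ?w")
  unfolding convex_on_def
proof (intro conjI ballI allI impI)
  fix s t u v :: real
  assume st: "s \<in> I" "t \<in> I" and uv: "0 \<le> u" "0 \<le> v" "u + v = 1"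
  obtain a where a: "a \<in> U" "F a \<le> s" "?w s = h a"
    using minimum_in[OF min[OF st(1)]] by auto
  obtain b where b: "b \<in> U" "F b \<le> t" "?w t = h b"
    using minimum_in[OF min[OF st(2)]] by auto
  let ?c = "u *\<^sub>R a + v *\<^sub>R b"
  have "F ?c \<le> u * F a + v * F b"
    using assms(2) a b uv unfolding convex_on_def by blast
  also have "\<dots> \<le> u * s + v * t"
    using a b uv by (intro add_mono mult_left_mono)
  finally have F: "F ?c \<le> u * s + v * t" .
  have c: "?c \<in> U"
    using assms(2) a b uv unfolding convex_on_def convex_def by blast
  have "u * s + v * t \<in> I"
    using convexD[OF assms(1) st uv] by simp
  then have "?w (u * s + v * t) \<le> h ?c"
    using F c by (intro minimum_le min) auto
  also have "\<dots> \<le> u * h a + v * h b"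
    using assms(3) a b uv unfolding convex_on_def by blast
  finally show "?w (u *\<^sub>R s + v *\<^sub>R t) \<le> u * ?w s + v * ?w t"
    using a b by simp
qed (rule assms(1))

lemma minimum_sublevel_lower_semicontinuous_on:
  assumes U: "compact U" and F: "lower_semicontinuous_on U F" and h: "lower_semicontinuous_on U h"
    and min: "\<And>\<eta>. \<eta> \<in> I \<Longrightarrow> has_minimum (h ` {\<theta> \<in> U. F \<theta> \<le> \<eta>})"
  shows "lower_semicontinuous_on I (\<lambda>\<eta>. minimum (h ` {\<theta> \<in> U. F \<theta> \<le> \<eta>}))"
    (is "lower_semicontinuous_on I ?w")
  unfolding lower_semicontinuous_on_def
proof (intro ballI allI impI)
  fix s c assume s: "s \<in> I" and c: "c < ?w s"
  \<comment> \<open>\<open>m\<close> is a level below which no point has value at most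
    \<open>c\<close>. If no such point exists at all, any number above \<open>s\<close> will
    do.\<close>
  obtain m where m: "s < m" "\<And>\<theta>. \<lbrakk>\<theta> \<in> U; h \<theta> \<le> c\<rbrakk> \<Longrightarrow> m \<le> F \<theta>"
  proof (cases "{\<theta> \<in> U. h \<theta> \<le> c} = {}")
    case True
    show ?thesis
      by (rule that[of "s + 1"]) (use True in auto)
  next
    case False
    \<comment> \<open>The existence lemma is applied with the roles of \<open>F\<close> and
      \<open>h\<close> exchanged.\<close>
    then have K: "has_minimum (F ` {\<theta> \<in> U. h \<theta> \<le> c})"
      using minimum_sublevel_has_minimum[OF U h F] by blast
    then obtain \<theta> where \<theta>: "\<theta> \<in> U" "h \<theta> \<le> c" "minimum (F ` {\<theta> \<in> U. h \<theta> \<le> c}) = F \<theta>"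
      using minimum_in[OF K] by auto
    have "s < F \<theta>"
    proof (rule ccontr)
      assume "\<not> s < F \<theta>"
      then have "?w s \<le> h \<theta>"
        using \<theta>(1) by (intro minimum_le min s) auto
      then show False using \<theta>(2) c by simp
    qed
    then show ?thesis
      using that minimum_le[OF K] \<theta>(3) by auto
  qed
  \<comment> \<open>A minimiser for the level \<open>t\<close> satisfies
    \<open>F \<theta> \<le> t < m\<close>, so its value cannot be at most \<open>c\<close>.\<close>
  have "c < ?w t" if t: "t \<in> I" "t < m" for t
    using minimum_in[OF min[OF t(1)]] m(2) t(2) by force
  then show "\<forall>\<^sub>F t in at s within I. c < ?w t"
    unfolding eventually_at_topological using m(1)
    by (intro exI[of _ "{..<m}"]) auto
qed

text \<open>Convexity alone permits a jump at \<open>a\<close>. There monotonicity bounds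
  \<open>w\<close> from above by \<open>w a\<close>, and lower semicontinuity supplies the bound
  from below.\<close>

lemma continuous_on_atLeast_convex:
  fixes w :: "real \<Rightarrow> real"
  assumes anti: "antimono_on {a..} w" and conv: "convex_on {a..} w"
    and lsc: "lower_semicontinuous_on {a..} w"
  shows "continuous_on {a..} w"
  unfolding continuous_on_eq_continuous_within
proof
  fix t assume t: "t \<in> {a..}"
  show "continuous (at t within {a..}) w"
  proof (cases "t = a")
    case True
    have "w s \<le> w a" if "s \<in> {a..}" for s
      using monotone_onD[OF anti] that by auto
    then have "\<forall>\<^sub>F s in at a within {a..}. w s < c" if "w a < c" for c
      using that unfolding eventually_at_topological
      by (intro exI[of _ UNIV]) (auto intro: le_less_trans)
    moreover have "\<forall>\<^sub>F s in at a within {a..}. c < w s" if "c < w a" for c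
      using lsc that unfolding lower_semicontinuous_on_def by auto
    ultimately have "(w \<longlongrightarrow> w a) (at a within {a..})"
      by (intro order_tendstoI)
    then show ?thesis
      by (simp add: continuous_within True)
  next
    case False
    \<comment> \<open>On the open half-line convexity gives continuity, and \<open>t\<close> is an
      interior point of it.\<close>
    have "convex_on {a<..} w"
      by (rule convex_on_subset[OF conv]) (auto simp: convex_real_interval)
    then have "continuous_on {a<..} w"
      by (intro convex_on_continuous) auto
    then have "continuous (at t) w"
      using False t by (auto simp: continuous_on_eq_continuous_at)
    then show ?thesis
      by (rule continuous_at_imp_continuous_at_within)
  qed
qed

text \<open>The existence clauses ensure that each \<open>maximum\<close> and \<open>minimum\<close>
  behind the three regularity claims is an attained extremum and not an unspecified value.\<close>

theorem proposition1:
  fixes X :: "'a::topological_space set"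
    and U :: "'b::{real_vector, topological_space} set"
    and f :: "'a \<times> 'b \<Rightarrow> real"
  assumes "X \<noteq> {}" and "compact X"
    and "U \<noteq> {}" and "compact U"
    and "bounded (f ` (X \<times> U))"
    and "\<And>\<theta>. \<theta> \<in> U \<Longrightarrow> upper_semicontinuous_on X (\<lambda>x. f (x, \<theta>))"
    and "\<And>x. x \<in> X \<Longrightarrow> lower_semicontinuous_on U (\<lambda>\<theta>. f (x, \<theta>))"
    and "convex U"
    and "\<And>x. x \<in> X \<Longrightarrow> convex_on U (\<lambda>\<theta>. f (x, \<theta>))"
  shows "(\<forall>\<theta>\<in>U. has_maximum ((\<lambda>x'. f (x', \<theta>)) ` X)) \<and>
    has_minimum (feasible_levels X U f) \<and>
    (\<forall>x\<in>X.
      (\<forall>\<eta>\<ge>eta_min X U f.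
        has_minimum ((\<lambda>\<theta>. f (x, \<theta>)) ` reduced_uncertainty_set X U f \<eta>)) \<and>
      antimono_on {eta_min X U f..} (reduced_value X U f x) \<and>
      convex_on {eta_min X U f..} (reduced_value X U f x) \<and>
      continuous_on {eta_min X U f..} (reduced_value X U f x))"
proof -
  define F where "F \<theta> = maximum ((\<lambda>x. f (x, \<theta>)) ` X)" for \<theta>
  have max: "has_maximum ((\<lambda>x. f (x, \<theta>)) ` X)" if "\<theta> \<in> U" for \<theta>
    using assms(2,1) assms(6)[OF that] by (rule upper_semicontinuous_on_has_maximum)
  have F_lsc: "lower_semicontinuous_on U F"
    unfolding F_def using max assms(7) by (rule lower_semicontinuous_on_maximum)
  have F_convex: "convex_on U F"
    unfolding F_def using max assms(8,9) by (rule convex_on_maximum)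
  have red: "reduced_uncertainty_set X U f = (\<lambda>\<eta>. {\<theta> \<in> U. F \<theta> \<le> \<eta>})"
    by (simp add: reduced_uncertainty_set_def F_def fun_eq_iff)
  have "has_minimum (F ` U)"
    using assms(4,3) F_lsc by (rule lower_semicontinuous_on_has_minimum)
  then obtain \<theta>\<^sub>0 where \<theta>\<^sub>0: "\<theta>\<^sub>0 \<in> U" "\<And>\<theta>. \<theta> \<in> U \<Longrightarrow> F \<theta>\<^sub>0 \<le> F \<theta>"
    unfolding has_minimum_def by blast
  \<comment> \<open>A level is feasible exactly when the minimiser \<open>\<theta>\<^sub>0\<close>
    of \<open>F\<close> is feasible for it.\<close>
  have levels: "feasible_levels X U f = {F \<theta>\<^sub>0..}"
    unfolding feasible_levels_def red using \<theta>\<^sub>0 by (auto intro: order_trans)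
  have feasible_min: "has_minimum (feasible_levels X U f)"
    unfolding levels has_minimum_def by auto
  have eta: "eta_min X U f = F \<theta>\<^sub>0"
    unfolding eta_min_def using minimum_in[OF feasible_min] minimum_le[OF feasible_min]
    by (simp add: levels order_antisym)
  have "(\<forall>\<eta>\<ge>eta_min X U f.
        has_minimum ((\<lambda>\<theta>. f (x, \<theta>)) ` reduced_uncertainty_set X U f \<eta>)) \<and>
      antimono_on {eta_min X U f..} (reduced_value X U f x) \<and>
      convex_on {eta_min X U f..} (reduced_value X U f x) \<and>
      continuous_on {eta_min X U f..} (reduced_value X U f x)" if x: "x \<in> X" for x
  proof -
    let ?h = "\<lambda>\<theta>. f (x, \<theta>)"
    have value_eq: "reduced_value X U f x = (\<lambda>\<eta>. minimum (?h ` {\<theta> \<in> U. F \<theta> \<le> \<eta>}))"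
      by (simp add: reduced_value_def red fun_eq_iff)
    have min: "has_minimum (?h ` {\<theta> \<in> U. F \<theta> \<le> \<eta>})" if "\<eta> \<in> {F \<theta>\<^sub>0..}" for \<eta>
      using minimum_sublevel_has_minimum[OF assms(4) F_lsc assms(7)[OF x] \<theta>\<^sub>0(1)] that by simp
    have anti: "antimono_on {F \<theta>\<^sub>0..} (reduced_value X U f x)"
      unfolding value_eq using min by (rule minimum_sublevel_antimono)
    have conv: "convex_on {F \<theta>\<^sub>0..} (reduced_value X U f x)"
      unfolding value_eq using convex_real_interval(1) F_convex assms(9)[OF x] min
      by (rule minimum_sublevel_convex_on)
    have lsc: "lower_semicontinuous_on {F \<theta>\<^sub>0..} (reduced_value X U f x)"
      unfolding value_eq using assms(4) F_lsc assms(7)[OF x] min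
      by (rule minimum_sublevel_lower_semicontinuous_on)
    show ?thesis
      using min anti conv continuous_on_atLeast_convex[OF anti conv lsc]
      by (simp add: eta red)
  qed
  then show ?thesis
    using max feasible_min by blast
qed

end
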